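(* Let $\mathcal{F}= \{ p_{a} : a\in I\}$ be a psychometric family that is anchored, parallel and balanced, and denote by $\xi$ the sensitivity function of $\mathcal{F}$, defined on $I\times S$. Then there exists a function $\nu\colon S\to \mathbb{R}$ which is antisymmetric with respect to the point $s_{0}= \frac{1}{2}$, i.e. $$\nu(1-s)= -\nu(s)\qquad (s\in S),$$ such that $$\xi_{s}(x)= x+\nu(s)$$ holds for all $x\in I$ and $s\in S$.
   Context: Every interval has positive length. A family of functions $\mathcal{F}= \{ p_{a} : a\in I\}$ is a psychometric family if for each fixed $a$: the domain of $p_a$ is an open interval, the range of $p_a$ is contained in $]0,1[$, and $p_a$ is strictly increasing and continuous. The sensitivity function $\xi$ of $\mathcal{F}$ is defined, for all $a\in I$ and all $\pi$ in the range of $p_a$, by $\xi_{\pi}(a)=p_{a}^{-1}(\pi)$. Standing assumption: $\xi$ is defined on a Cartesian product $I\times S$ of real intervals, i.e. $S\subset\,]0,1[$ is the interval of probabilities $s$ for which $\xi_s(a)$ is defined for every $a\in I$; it is implicit that $1-s\in S$ for $s\in S$. $\mathcal{F}$ is anchored if there exists $\alpha \in\, ]0, 1[$ such that (i) for all $a\in I$ there exists $x$ satisfying $p_{a}(x)= \alpha$; (ii) for all $x$ there exists $a\in I$ such that $p_{a}(x)= \alpha$. $\mathcal{F}$ is parallel if for all $p_{a}, p_{b}\in \mathcal{F}$ we have $p_{a}^{-1}(\pi)-p_{a}^{-1}(\pi^{\ast})=p_{b}^{-1}(\pi)-p_{b}^{-1}(\pi^{\ast})$ whenever all four terms are defined.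 $\mathcal{F}$ is balanced if $p_{a}(b)+p_{b}(a)=1$ for all possible $a$ and $b$; this is used in the paper in the equivalent form $\xi_{1-\pi}(\xi_{\pi}(a))=a$ for all $\pi$ and $a$. *)

theory Defs
  imports "HOL-Analysis.Analysis"
begin

text \<open>
  A family of partial functions indexed by a set \<open>I\<close> of reals is given by the domains \<open>D a\<close> and the
  functions \<open>p a\<close>; the values of \<open>p a\<close> outside \<open>D a\<close>, and \<open>D a\<close>, \<open>p a\<close> for \<open>a\<close> outside \<open>I\<close>, are
  irrelevant. All intervals have positive length.
\<close>

definition proper_interval :: "real set \<Rightarrow> bool" where
  "proper_interval A \<longleftrightarrow> is_interval A \<and> (\<exists>x\<in>A. \<exists>y\<in>A. x < y)"

definition psychometric_family ::
  "real set \<Rightarrow> (real \<Rightarrow> real set) \<Rightarrow> (real \<Rightarrow> real \<Rightarrow> real) \<Rightarrow> bool" where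
  "psychometric_family I D p \<longleftrightarrow>
     (\<forall>a\<in>I. open (D a) \<and> proper_interval (D a) \<and> p a ` D a \<subseteq> {0<..<1} \<and>
            strict_mono_on (D a) (p a) \<and> continuous_on (D a) (p a))"

text \<open>\<open>sensitivity D p s a\<close> is meaningful only for \<open>s \<in> p a ` D a\<close>.\<close>

definition sensitivity ::
  "(real \<Rightarrow> real set) \<Rightarrow> (real \<Rightarrow> real \<Rightarrow> real) \<Rightarrow> real \<Rightarrow> real \<Rightarrow> real" where
  "sensitivity D p s a = inv_into (D a) (p a) s"

text \<open>The set \<open>S\<close> of all probabilities at which the sensitivity is defined for every index.\<close>

definition common_probs ::
  "real set \<Rightarrow> (real \<Rightarrow> real set) \<Rightarrow> (real \<Rightarrow> real \<Rightarrow> real) \<Rightarrow> real set" where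
  "common_probs I D p = {s \<in> {0<..<1}. \<forall>a\<in>I. s \<in> p a ` D a}"

text \<open>
  Indices and arguments are stimuli on one common scale (balance exchanges them). An unrestricted
  stimulus \<open>x\<close> therefore ranges over all reals that occur as an index or as an argument.
\<close>

definition stimuli :: "real set \<Rightarrow> (real \<Rightarrow> real set) \<Rightarrow> real set" where
  "stimuli I D = I \<union> (\<Union>a\<in>I. D a)"

definition anchored ::
  "real set \<Rightarrow> (real \<Rightarrow> real set) \<Rightarrow> (real \<Rightarrow> real \<Rightarrow> real) \<Rightarrow> bool" where
  "anchored I D p \<longleftrightarrow>
     (\<exists>\<alpha>\<in>{0<..<1}.
        (\<forall>a\<in>I. \<exists>x\<in>D a. p a x = \<alpha>) \<and>
        (\<forall>x\<in>stimuli I D. \<exists>a\<in>I. x \<in> D a \<and> p a x = \<alpha>))"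

definition parallel ::
  "real set \<Rightarrow> (real \<Rightarrow> real set) \<Rightarrow> (real \<Rightarrow> real \<Rightarrow> real) \<Rightarrow> bool" where
  "parallel I D p \<longleftrightarrow>
     (\<forall>a\<in>I. \<forall>b\<in>I. \<forall>s \<in> p a ` D a \<inter> p b ` D b. \<forall>t \<in> p a ` D a \<inter> p b ` D b.
        sensitivity D p s a - sensitivity D p t a = sensitivity D p s b - sensitivity D p t b)"

text \<open>
  The pairs for which \<open>p a b + p b a = 1\<close> is demanded are those indices \<open>a\<close>, \<open>b\<close> for which \<open>p a b\<close> is
  defined; \<open>p b a\<close> must then be defined too. In terms of the sensitivity \<open>\<xi>\<close> this says that
  \<open>\<xi> (1 - s) (\<xi> s a) = a\<close> (with the left-hand side defined) whenever \<open>\<xi> s a\<close> is defined and is an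
  index. Demanding the equation only when both \<open>p a b\<close> and \<open>p b a\<close> happen to be defined would be
  strictly weaker, and vacuous if \<open>p a b\<close> is defined only for \<open>b > a\<close>.
\<close>

definition balanced ::
  "real set \<Rightarrow> (real \<Rightarrow> real set) \<Rightarrow> (real \<Rightarrow> real \<Rightarrow> real) \<Rightarrow> bool" where
  "balanced I D p \<longleftrightarrow> (\<forall>a\<in>I. \<forall>b\<in>I. b \<in> D a \<longrightarrow> a \<in> D b \<and> p a b + p b a = 1)"

end

theory Submission
  imports Defs
begin

text \<open>
  Write \<open>f\<close> for the sensitivity at the anchor \<open>\<alpha>\<close>. Parallelism says that the sensitivities at any
  two levels differ by a constant, so \<open>\<xi> s a = f a + c s\<close> for a strictly increasing \<open>c\<close> with
  \<open>c \<alpha> = 0\<close>. What has to be shown is that \<open>f\<close> is a translation. The governing idea is that the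
  sensitivity at level \<open>1/2\<close>, that is \<open>g = f + c (1/2)\<close>, is by balance an involution wherever it
  takes values in \<open>I\<close>, and that an increasing involution is the identity. Two things stand in the
  way: the hypotheses do not include that \<open>g\<close> increases with the index, and \<open>g\<close> may leave \<open>I\<close>.

  Both are overcome on the set \<open>J = f ` I + c (1 - \<alpha>)\<close>. Anchoring makes \<open>f ` I\<close> the set of all
  stimuli, so that it contains \<open>I\<close>, and balance at the anchor then yields \<open>J \<subseteq> I\<close>. Every
  value \<open>f a + c s\<close> is a stimulus, hence \<open>J\<close> is closed under adding elements of \<open>c ` S\<close>, an interval of
  positive length that contains \<open>0\<close>; in particular \<open>J\<close> is a half-line or the whole line. On \<open>J\<close>,
  balance at level \<open>s\<close> compared with balance at the anchor gives
  \<open>f (y + c s) = f y + c (1 - \<alpha>) - c (1 - s)\<close>, so that \<open>f\<close> increases over short steps and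
  therefore on all of \<open>J\<close>. The involution argument now gives \<open>f y = y - c (1/2)\<close> on \<open>J\<close>, balance
  at the anchor carries this formula from \<open>J\<close> to \<open>I\<close>, and \<open>\<nu> s = c s - c (1/2)\<close>.
  The whole argument about \<open>f\<close> and \<open>c\<close> is the lemma \<open>anchored_balanced_translation\<close>.
\<close>

lemma less_if_short_steps_increase:
  fixes f :: "real \<Rightarrow> real" and J :: "real set"
  assumes "0 < \<delta>"
    and step: "\<And>u t. u \<in> J \<Longrightarrow> 0 < t \<Longrightarrow> t \<le> \<delta> \<Longrightarrow> u + t \<in> J \<and> f u < f (u + t)"
    and "y \<in> J" "y < z"
  shows "f y < f z"
proof -
  obtain n :: nat where n: "(z - y) / \<delta> < real n"
    using reals_Archimedean2 by blast
  have "0 < (z - y) / \<delta>" using assms by simp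
  then have n0: "0 < real n" using n by linarith
  define t where "t = (z - y) / real n"
  have t: "0 < t" "t \<le> \<delta>"
    using n n0 assms(1,4) by (auto simp: t_def field_simps)
  have "y + real (Suc k) * t \<in> J \<and> f y < f (y + real (Suc k) * t)" for k
  proof (induction k)
    case 0
    then show ?case using step[OF assms(3) t] by simp
  next
    case (Suc k)
    have eq: "y + real (Suc (Suc k)) * t = (y + real (Suc k) * t) + t"
      by (simp add: algebra_simps)
    show ?case
      unfolding eq using step[OF _ t, of "y + real (Suc k) * t"] Suc less_trans by blast
  qed
  from this[of "n - 1"] have "f y < f (y + real n * t)" using n0 by simp
  moreover have "y + real n * t = z" using n0 by (simp add: t_def)
  ultimately show ?thesis by simp
qed

text \<open>
  The interval \<open>c ` S\<close> may have \<open>0\<close> as an endpoint (when the anchor is an endpoint of \<open>S\<close>), so only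
  one of the two directions of stepping is available in general. Stepping downwards is reduced to
  stepping upwards by the point reflection \<open>x \<mapsto> - f (- x)\<close>.
\<close>

lemma strict_mono_on_if_interval_steps_increase:
  fixes f :: "real \<Rightarrow> real" and J C :: "real set"
  assumes C: "is_interval C" "0 \<in> C" "\<delta> \<in> C" "\<delta> \<noteq> 0"
    and closed: "\<And>u t. u \<in> J \<Longrightarrow> t \<in> C \<Longrightarrow> u + t \<in> J"
    and up: "\<And>u t. u \<in> J \<Longrightarrow> t \<in> C \<Longrightarrow> 0 < t \<Longrightarrow> f u < f (u + t)"
    and down: "\<And>u t. u \<in> J \<Longrightarrow> t \<in> C \<Longrightarrow> t < 0 \<Longrightarrow> f (u + t) < f u"
  shows "strict_mono_on J f"
proof (rule strict_mono_onI)
  fix y z assume yz: "y \<in> J" "z \<in> J" "y < z"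
  show "f y < f z"
  proof (cases "0 < \<delta>")
    case True
    have "t \<in> C" if "0 < t" "t \<le> \<delta>" for t
      using mem_is_interval_1_I[OF C(1-3), of t] that by simp
    then show ?thesis
      using less_if_short_steps_increase[of \<delta> J f y z] True closed up yz by blast
  next
    case False
    then have neg: "0 < - \<delta>" using C(4) by simp
    have inC: "- t \<in> C" if "0 < t" "t \<le> - \<delta>" for t
      using mem_is_interval_1_I[OF C(1,3,2), of "- t"] that by simp
    have step: "u + t \<in> uminus ` J \<and> - f (- u) < - f (- (u + t))"
      if "u \<in> uminus ` J" "0 < t" "t \<le> - \<delta>" for u t
    proof -
      have "- u \<in> J" using that(1) by auto
      with inC[OF that(2,3)] closed[of "- u" "- t"] down[of "- u" "- t"] that(2)
      have "- (u + t) \<in> J" "f (- (u + t)) < f (- u)" by simp_all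
      then show ?thesis by force
    qed
    have "- f (- (- z)) < - f (- (- y))"
      by (rule less_if_short_steps_increase[of "- \<delta>" "uminus ` J" "\<lambda>x. - f (- x)"])
        (use neg step yz in auto)
    then show ?thesis by simp
  qed
qed

text \<open>
  Here \<open>f a + c s\<close> is the sensitivity of index \<open>a\<close> at level \<open>s\<close>, the set \<open>f ` I\<close> consists of all
  stimuli, and \<open>balance\<close> is the equation \<open>\<xi> (1 - s) (\<xi> s a) = a\<close>.
\<close>

lemma anchored_balanced_translation:
  fixes I S :: "real set" and f c :: "real \<Rightarrow> real" and \<alpha> :: real
  assumes "I \<noteq> {}" and \<alpha>: "\<alpha> \<in> S" "c \<alpha> = 0" and "1/2 \<in> S"
    and nontriv: "\<delta> \<in> S" "\<delta> \<noteq> \<alpha>"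
    and sym: "\<And>s. s \<in> S \<Longrightarrow> 1 - s \<in> S"
    and mono: "strict_mono_on S c" and intv: "is_interval (c ` S)"
    and sub: "I \<subseteq> f ` I"
    and stim: "\<And>a s. a \<in> I \<Longrightarrow> s \<in> S \<Longrightarrow> f a + c s \<in> f ` I"
    and balance: "\<And>a s. a \<in> I \<Longrightarrow> s \<in> S \<Longrightarrow> f a + c s \<in> I \<Longrightarrow> f (f a + c s) = a - c (1 - s)"
  shows "\<forall>x\<in>I. f x = x - c (1/2)" and "\<forall>s\<in>S. c s + c (1 - s) = 2 * c (1/2)"
proof -
  define \<gamma> where "\<gamma> = c (1 - \<alpha>)"
  define m where "m = c (1/2)"
  define J where "J = (\<lambda>x. f x + \<gamma>) ` I"
  \<comment> \<open>Balance at the anchor: \<open>f + \<gamma>\<close> maps \<open>I\<close> into itself and is a right inverse of \<open>f\<close>.\<close>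
  have inverse: "f x + \<gamma> \<in> I \<and> f (f x + \<gamma>) = x" if "x \<in> I" for x
  proof -
    have "x \<in> f ` I" using sub that by blast
    then obtain a where a: "a \<in> I" "x = f a" by blast
    then have "f x = a - \<gamma>" using balance[of a \<alpha>] \<alpha> that by (simp add: \<gamma>_def)
    then show ?thesis using a by simp
  qed
  have JI: "J \<subseteq> I" using inverse by (auto simp: J_def)
  have J_closed: "y + c s \<in> J" if "y \<in> J" "s \<in> S" for y s
  proof -
    obtain x where x: "x \<in> I" "y = f x + \<gamma>" using \<open>y \<in> J\<close> by (auto simp: J_def)
    obtain x' where "x' \<in> I" "f x + c s = f x'" using stim[OF x(1) \<open>s \<in> S\<close>] by auto
    then have "x' \<in> I" "y + c s = f x' + \<gamma>" using x by simp_all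
    then show ?thesis by (auto simp: J_def)
  qed
  have shift: "f (y + c s) = f y + \<gamma> - c (1 - s)" if "y \<in> J" "s \<in> S" for y s
  proof -
    have "y \<in> I" "y + c s \<in> I" using J_closed[OF that] JI that(1) by auto
    then show ?thesis using balance[of "f y + \<gamma>" s] inverse[of y] that(2) by simp
  qed
  have c_less: "c s < c t \<longleftrightarrow> s < t" if "s \<in> S" "t \<in> S" for s t
    using strict_mono_on_less[OF mono that] .
  have f_mono: "strict_mono_on J f"
  proof (rule strict_mono_on_if_interval_steps_increase[of "c ` S" "c \<delta>"])
    show "0 \<in> c ` S" using \<alpha> by force
    show "c \<delta> \<noteq> 0"
      using c_less[OF nontriv(1) \<alpha>(1)] c_less[OF \<alpha>(1) nontriv(1)] nontriv(2) \<alpha>(2) by auto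
    show "f u < f (u + t)" if ut: "u \<in> J" "t \<in> c ` S" "0 < t" for u t
    proof -
      obtain s where s: "s \<in> S" "t = c s" using ut by auto
      have "\<alpha> < s" using c_less[OF \<alpha>(1) s(1)] \<alpha>(2) s ut by simp
      then have "c (1 - s) < \<gamma>" using c_less sym s(1) \<alpha>(1) by (simp add: \<gamma>_def)
      then show ?thesis using shift[OF ut(1) s(1)] s by simp
    qed
    show "f (u + t) < f u" if ut: "u \<in> J" "t \<in> c ` S" "t < 0" for u t
    proof -
      obtain s where s: "s \<in> S" "t = c s" using ut by auto
      have "s < \<alpha>" using c_less[OF s(1) \<alpha>(1)] \<alpha>(2) s ut by simp
      then have "\<gamma> < c (1 - s)" using c_less sym s(1) \<alpha>(1) by (simp add: \<gamma>_def)
      then show ?thesis using shift[OF ut(1) s(1)] s by simp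
    qed
  qed (use intv nontriv J_closed in auto)
  \<comment> \<open>The increasing involution \<open>g = f + m\<close> interchanges \<open>f y + \<gamma>\<close> and \<open>y + m\<close>, so these coincide.\<close>
  have fixed: "f y + \<gamma> = y + m" "f (y + m) = y" if y: "y \<in> J" for y
  proof -
    have a: "f y + \<gamma> \<in> J" "f y + \<gamma> \<in> I" "f (f y + \<gamma>) = y" using y JI inverse by (auto simp: J_def)
    have b: "y + m \<in> J" using J_closed[OF y \<open>1/2 \<in> S\<close>] by (simp add: m_def)
    have fb: "f (y + m) = f y + \<gamma> - m" using shift[OF y \<open>1/2 \<in> S\<close>] by (simp add: m_def)
    show "f y + \<gamma> = y + m"
    proof (rule linorder_cases)
      assume "f y + \<gamma> < y + m"
      then have "y < f (y + m)" using strict_mono_onD[OF f_mono a(1) b] a(3) by simp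
      then show ?thesis using fb \<open>f y + \<gamma> < y + m\<close> by linarith
    next
      assume "y + m < f y + \<gamma>"
      then have "f (y + m) < y" using strict_mono_onD[OF f_mono b a(1)] a(3) by simp
      then show ?thesis using fb \<open>y + m < f y + \<gamma>\<close> by linarith
    qed
    then show "f (y + m) = y" using fb by linarith
  qed
  obtain x0 where "x0 \<in> I" using \<open>I \<noteq> {}\<close> by blast
  then obtain y0 where y0: "y0 \<in> J" by (auto simp: J_def)
  have "y0 + m \<in> J" using J_closed[OF y0 \<open>1/2 \<in> S\<close>] by (simp add: m_def)
  then have \<gamma>: "\<gamma> = 2 * m" using fixed(1)[of "y0 + m"] fixed(2)[OF y0] by linarith
  have translation: "f x = x - m" if "x \<in> I" for x
  proof -
    have "f x + \<gamma> \<in> J" "f (f x + \<gamma>) = x" using that inverse by (auto simp: J_def)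
    then show ?thesis using fixed(1)[of "f x + \<gamma>"] \<gamma> by simp
  qed
  then show "\<forall>x\<in>I. f x = x - c (1/2)" by (simp add: m_def)
  show "\<forall>s\<in>S. c s + c (1 - s) = 2 * c (1/2)"
  proof
    fix s assume s: "s \<in> S"
    have "y0 + c s \<in> I" "y0 \<in> I" using J_closed[OF y0 s] y0 JI by auto
    then show "c s + c (1 - s) = 2 * c (1/2)"
      using shift[OF y0 s] translation[of "y0 + c s"] translation[of y0] \<gamma>
      by (simp add: m_def)
  qed
qed

lemma half_mem_if_reflection_closed:
  fixes S :: "real set"
  assumes "is_interval S" "s \<in> S" "1 - s \<in> S"
  shows "1/2 \<in> S"
proof (cases "s \<le> 1/2")
  case True
  then show ?thesis using mem_is_interval_1_I[OF assms, of "1/2"] by simp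
next
  case False
  then show ?thesis using mem_is_interval_1_I[OF assms(1,3,2), of "1/2"] by simp
qed

theorem proposition3:
  fixes I S :: "real set"
    and D :: "real \<Rightarrow> real set"
    and p :: "real \<Rightarrow> real \<Rightarrow> real"
  assumes "psychometric_family I D p"
    and "S = common_probs I D p"
    and "proper_interval I" and "proper_interval S"
    and "\<forall>s\<in>S. 1 - s \<in> S"
    and "anchored I D p"
    and "parallel I D p"
    and "balanced I D p"
  shows "\<exists>\<nu> :: real \<Rightarrow> real.
           (\<forall>s\<in>S. \<nu> (1 - s) = - \<nu> s) \<and>
           (\<forall>x\<in>I. \<forall>s\<in>S. sensitivity D p s x = x + \<nu> s)"
proof -
  let ?\<xi> = "sensitivity D p"
  have smono: "strict_mono_on (D a) (p a)" and D_int: "is_interval (D a)" if "a \<in> I" for a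
    using assms(1) that by (auto simp: psychometric_family_def proper_interval_def)
  have \<xi>: "?\<xi> s a \<in> D a" "p a (?\<xi> s a) = s" if "a \<in> I" "s \<in> S" for s a
    using that assms(2)
    by (auto simp: common_probs_def sensitivity_def inv_into_into f_inv_into_f)
  have \<xi>_eq: "?\<xi> (p a x) a = x" if "a \<in> I" "x \<in> D a" for a x
    using that strict_mono_on_imp_inj_on[OF smono] by (simp add: sensitivity_def)
  obtain \<alpha> where \<alpha>: "\<alpha> \<in> {0<..<1}" "\<And>a. a \<in> I \<Longrightarrow> \<exists>x\<in>D a. p a x = \<alpha>"
    and onto: "\<And>x. x \<in> stimuli I D \<Longrightarrow> \<exists>a\<in>I. x \<in> D a \<and> p a x = \<alpha>"
    using assms(6) unfolding anchored_def by blast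
  have \<alpha>S: "\<alpha> \<in> S" using \<alpha> assms(2) by (force simp: common_probs_def)
  obtain a0 where a0: "a0 \<in> I" using assms(3) by (auto simp: proper_interval_def)
  have Sint: "is_interval S" using assms(4) by (simp add: proper_interval_def)
  obtain \<delta> where \<delta>: "\<delta> \<in> S" "\<delta> \<noteq> \<alpha>"
    using assms(4) unfolding proper_interval_def by (metis less_irrefl)
  define f where "f = ?\<xi> \<alpha>"
  define c where "c s = ?\<xi> s a0 - ?\<xi> \<alpha> a0" for s
  have \<xi>_fc: "?\<xi> s a = f a + c s" if "a \<in> I" "s \<in> S" for a s
  proof -
    have "s \<in> p a ` D a \<inter> p a0 ` D a0" "\<alpha> \<in> p a ` D a \<inter> p a0 ` D a0"
      using that a0 \<alpha>S assms(2) by (auto simp: common_probs_def)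
    then have "?\<xi> s a - ?\<xi> \<alpha> a = ?\<xi> s a0 - ?\<xi> \<alpha> a0"
      using assms(7) that(1) a0 unfolding parallel_def by blast
    then show ?thesis by (simp add: f_def c_def)
  qed
  have stimuli: "stimuli I D \<subseteq> f ` I"
  proof
    fix x assume "x \<in> stimuli I D"
    then obtain a where "a \<in> I" "x \<in> D a" "p a x = \<alpha>" using onto by blast
    then have "f a = x" using \<xi>_eq by (auto simp: f_def)
    then show "x \<in> f ` I" using \<open>a \<in> I\<close> by blast
  qed
  have half: "1/2 \<in> S"
    using half_mem_if_reflection_closed[OF Sint \<delta>(1)] assms(5) \<delta>(1) by blast
  have c_mono: "strict_mono_on S c"
  proof (rule strict_mono_onI)
    fix s t assume "s \<in> S" "t \<in> S" "s < t"
    then show "c s < c t"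
      using strict_mono_on_less[OF smono[OF a0], of "?\<xi> s a0" "?\<xi> t a0"] \<xi>[OF a0]
      by (simp add: c_def)
  qed
  have c_int: "is_interval (c ` S)"
    unfolding is_interval_1
  proof (intro ballI allI impI, elim conjE)
    fix u v w assume "u \<in> c ` S" "w \<in> c ` S" "u \<le> v" "v \<le> w"
    then obtain s t where st: "s \<in> S" "t \<in> S" "u = c s" "w = c t" by auto
    \<comment> \<open>The point of \<open>D a0\<close> that lies at distance \<open>v\<close> from the anchor point of \<open>a0\<close>.\<close>
    define x where "x = v + ?\<xi> \<alpha> a0"
    have sxt: "?\<xi> s a0 \<le> x" "x \<le> ?\<xi> t a0"
      using \<open>u \<le> v\<close> \<open>v \<le> w\<close> st by (auto simp: x_def c_def)
    then have xD: "x \<in> D a0"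
      using mem_is_interval_1_I[OF D_int[OF a0]] \<xi>(1)[OF a0] st by blast
    have "p a0 x \<in> S"
    proof (rule mem_is_interval_1_I[OF Sint st(1,2)])
      show "s \<le> p a0 x" "p a0 x \<le> t"
        using strict_mono_on_leD[OF smono[OF a0]] xD sxt \<xi>[OF a0] st by metis+
    qed
    moreover have "v = c (p a0 x)" using \<xi>_eq[OF a0 xD] by (simp add: c_def x_def)
    ultimately show "v \<in> c ` S" by blast
  qed
  have stim: "f a + c s \<in> f ` I" if "a \<in> I" "s \<in> S" for a s
  proof -
    have "?\<xi> s a \<in> stimuli I D" using \<xi>(1)[OF that] that(1) by (auto simp: stimuli_def)
    then show ?thesis using stimuli \<xi>_fc[OF that] by auto
  qed
  have balance: "f (f a + c s) = a - c (1 - s)" if as: "a \<in> I" "s \<in> S" "f a + c s \<in> I" for a s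
  proof -
    let ?b = "?\<xi> s a"
    have b: "?b \<in> I" "f a + c s = ?b" using \<xi>_fc[OF as(1,2)] as(3) by simp_all
    have "a \<in> D ?b \<and> p a ?b + p ?b a = 1"
      using assms(8) \<xi>(1)[OF as(1,2)] as(1) b(1) unfolding balanced_def by blast
    then have "a \<in> D ?b" "p ?b a = 1 - s" using \<xi>(2)[OF as(1,2)] by auto
    then have "?\<xi> (1 - s) ?b = a" using \<xi>_eq[OF b(1)] by force
    then show ?thesis using \<xi>_fc[OF b(1), of "1 - s"] assms(5) as(2) b(2) by simp
  qed
  have "I \<subseteq> f ` I" using stimuli by (auto simp: stimuli_def)
  moreover have "I \<noteq> {}" "c \<alpha> = 0" using a0 by (auto simp: c_def)
  ultimately have tr: "\<forall>x\<in>I. f x = x - c (1/2)" "\<forall>s\<in>S. c s + c (1 - s) = 2 * c (1/2)"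
    using anchored_balanced_translation[of I \<alpha> S c \<delta> f] \<alpha>S half \<delta> c_mono c_int stim balance assms(5)
    by blast+
  show ?thesis
  proof (intro exI[of _ "\<lambda>s. c s - c (1/2)"] conjI ballI)
    fix s assume "s \<in> S"
    then have "c s + c (1 - s) = 2 * c (1/2)" using tr(2) by blast
    then show "c (1 - s) - c (1/2) = - (c s - c (1/2))" by linarith
  next
    fix x s assume "x \<in> I" "s \<in> S"
    then show "?\<xi> s x = x + (c s - c (1/2))" using tr(1) \<xi>_fc by simp
  qed
qed

end
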